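(* Let $h\in\mathbb R\setminus\{0\}$. The function $x\mapsto e_h(x,y)$ is the eigenfunction of the operator $\dfrac{d}{d_h x}$ with eigenvalue $y$, i.e. $$\frac{d}{d_h x}\,e_h(x,y)=y\,e_h(x,y).$$
   Context: For $h\in\mathbb R\setminus\{0\}$, the deformed exponential function $e_h$ of two variables is $$e_h(x,y)=(1+hx)^{y/h}\qquad (x\in\mathbb C\setminus\{-1/h\},\ y\in\mathbb R).$$ For $u\neq -1/h$ set $$z\ominus_h u=\frac{z-u}{1+hu}.$$ The deformed $h$-derivative is $$\frac{df(z)}{d_hz}=\lim_{u\to z}\frac{f(z)-f(u)}{z\ominus_h u}=(1+hz)\,\frac{df(z)}{dz}.$$ *)

theory Defs
  imports "HOL-Complex_Analysis.Complex_Analysis"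
begin

definition h_minus :: "real \<Rightarrow> complex \<Rightarrow> complex \<Rightarrow> complex" where
  "h_minus h z u = (z - u) / (1 + of_real h * u)"

(* The h-derivative of f at z exists and equals D.  It is meant for z \<noteq> -1/h; then u \<noteq> -1/h
   for all u near z, so the totalized division in h_minus does not affect the limit. *)
definition has_h_derivative :: "real \<Rightarrow> (complex \<Rightarrow> complex) \<Rightarrow> complex \<Rightarrow> complex \<Rightarrow> bool" where
  "has_h_derivative h f D z \<longleftrightarrow> ((\<lambda>u. (f z - f u) / h_minus h z u) \<longlongrightarrow> D) (at z)"

(* The power w^(y/h) is multivalued, and no single-valued choice is continuous on the whole of
   \<complex> - {0} unless y/h is an integer.  A choice of the power is given by a branch of the logarithm. *)
definition log_branch :: "(complex \<Rightarrow> complex) \<Rightarrow> complex set \<Rightarrow> bool" where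
  "log_branch L V \<longleftrightarrow> open V \<and> V \<noteq> {} \<and> continuous_on V L \<and> (\<forall>w\<in>V. exp (L w) = w)"

(* e_h(x,y) = (1 + h x)^(y/h), where w^a = exp (a * L w) for the branch L.  For L = Ln and
   x \<noteq> -1/h this is (1 + h x) powr (y/h). *)
definition deformed_exp ::
  "(complex \<Rightarrow> complex) \<Rightarrow> real \<Rightarrow> complex \<Rightarrow> real \<Rightarrow> complex" where
  "deformed_exp L h x y = exp (of_real (y / h) * L (1 + of_real h * x))"

definition h_eigenfunction_on ::
  "real \<Rightarrow> complex set \<Rightarrow> (complex \<Rightarrow> complex) \<Rightarrow> complex \<Rightarrow> bool" where
  "h_eigenfunction_on h S f \<mu> \<longleftrightarrow>
     (\<exists>x\<in>S. f x \<noteq> 0) \<and> (\<forall>x\<in>S. has_h_derivative h f (\<mu> * f x) x)"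

end

theory Submission
  imports Defs
begin

text \<open>
  The h-difference quotient is the ordinary one multiplied by \<open>1 + h u\<close>, so the
  h-derivative is \<open>(1 + h z) f'(z)\<close> (\<open>has_h_derivative_of_field_derivative\<close>).  A continuous branch of
  the logarithm is a continuous right inverse of \<open>exp\<close>, hence holomorphic with derivative \<open>1/w\<close>
  (\<open>log_branch_has_field_derivative\<close>).  By the chain rule, \<open>exp ((y/h) L (1 + h x))\<close> has the
  logarithmic derivative \<open>(y/h) h / (1 + h x) = y / (1 + h x)\<close>, and the factor \<open>1 + h x\<close> of the
  h-derivative cancels the denominator, which leaves the eigenvalue \<open>y\<close>.  Since being a derivative is a
  local property, the principal power, which agrees with the power for the branch \<open>Ln\<close> off the cut,
  is covered by the same argument.  Every nonzero point lies in the domain of some branch, because the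
  principal branch can be rotated so that its cut avoids the point.
\<close>

lemma has_h_derivative_of_field_derivative:
  assumes "(f has_field_derivative f') (at z)"
  shows "has_h_derivative h f ((1 + of_real h * z) * f') z"
proof -
  have "((\<lambda>u. (1 + of_real h * u) * ((f u - f z) / (u - z))) \<longlongrightarrow> (1 + of_real h * z) * f') (at z)"
    using assms by (intro tendsto_intros) (simp add: has_field_derivative_iff)
  moreover have "(1 + of_real h * u) * ((f u - f z) / (u - z)) = (f z - f u) / h_minus h z u" for u
    using minus_divide_divide[of "(f u - f z) * (1 + of_real h * u)" "u - z"]
    by (simp add: h_minus_def mult.commute flip: mult_minus_left mult_minus_right)
  ultimately show ?thesis
    by (simp add: has_h_derivative_def)
qed

lemma log_branch_nonzero: "log_branch L V \<Longrightarrow> w \<in> V \<Longrightarrow> w \<noteq> 0"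
  by (metis exp_not_eq_zero log_branch_def)

text \<open>
  This is the inverse function rule: \<open>L\<close> is a right inverse of \<open>exp\<close>, and its continuity is what
  makes it differentiable.
\<close>
lemma log_branch_has_field_derivative:
  assumes L: "log_branch L V" and w: "w \<in> V"
  shows "(L has_field_derivative inverse w) (at w)"
proof (rule has_field_derivative_inverse_basic[where f = exp and t = V])
  show "(exp has_field_derivative w) (at (L w))"
    using L w DERIV_exp[of "L w"] by (simp add: log_branch_def)
  show "continuous (at w) L"
    using L w by (auto simp: log_branch_def continuous_on_eq_continuous_at)
qed (use L w log_branch_nonzero[OF L w] in \<open>auto simp: log_branch_def\<close>)

lemma deformed_exp_has_field_derivative:
  assumes "h \<noteq> 0" and L: "log_branch L V" and x: "1 + of_real h * x \<in> V"
  shows "((\<lambda>x. deformed_exp L h x y) has_field_derivative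
           of_real y * deformed_exp L h x y / (1 + of_real h * x)) (at x)"
proof -
  have "((\<lambda>x. 1 + of_real h * x) has_field_derivative of_real h) (at x)"
    by (auto intro!: derivative_eq_intros)
  then have "((\<lambda>x. L (1 + of_real h * x)) has_field_derivative
                inverse (1 + of_real h * x) * of_real h) (at x)"
    by (rule DERIV_chain2[where f = L and x = x and g = "\<lambda>x. 1 + of_real h * x",
          OF log_branch_has_field_derivative[OF L x]])
  from DERIV_chain2[OF DERIV_exp DERIV_cmult[OF this, of "of_real (y / h)"]] show ?thesis
    using \<open>h \<noteq> 0\<close> by (simp add: deformed_exp_def field_simps)
qed

text \<open>
  Only the values of \<open>f\<close> near the points of the open domain matter, so \<open>f\<close> is asked to be the
  deformed exponential there and nowhere else.  This lets the lemma apply to the principal power,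
  which is \<open>0\<close> at \<open>-1/h\<close> while the deformed exponential never vanishes.
\<close>
lemma h_eigenfunction_on_log_branch:
  assumes h: "h \<noteq> 0" and L: "log_branch L V"
    and f: "\<And>x. 1 + of_real h * x \<in> V \<Longrightarrow> f x = deformed_exp L h x y"
  shows "h_eigenfunction_on h {x. 1 + of_real h * x \<in> V} f (of_real y)"
proof -
  define S where "S = {x. 1 + complex_of_real h * x \<in> V}"
  have "open ((\<lambda>x. 1 + complex_of_real h * x) -` V)"
    using L by (intro open_vimage continuous_intros) (simp add: log_branch_def)
  then have S: "open S"
    by (simp add: S_def vimage_def)
  have "\<exists>x\<in>S. f x \<noteq> 0"
  proof -
    obtain w where "w \<in> V"
      using L by (auto simp: log_branch_def)
    then have "(w - 1) / of_real h \<in> S"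
      using h by (simp add: S_def)
    then show ?thesis
      using f by (metis S_def deformed_exp_def exp_not_eq_zero mem_Collect_eq)
  qed
  moreover have "has_h_derivative h f (of_real y * f x) x" if "x \<in> S" for x
  proof -
    have x: "1 + of_real h * x \<in> V"
      using that by (simp add: S_def)
    have "(f has_field_derivative of_real y * deformed_exp L h x y / (1 + of_real h * x)) (at x)"
      by (rule has_field_derivative_transform_within_open
          [OF deformed_exp_has_field_derivative[OF h L x] S that])
        (simp add: S_def f)
    from has_h_derivative_of_field_derivative[OF this, of h] show ?thesis
      using log_branch_nonzero[OF L x] by (simp add: f[OF x])
  qed
  ultimately show ?thesis
    by (simp add: h_eigenfunction_on_def S_def)
qed

lemma log_branch_Ln: "log_branch Ln (- \<real>\<^sub>\<le>\<^sub>0)"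
  unfolding log_branch_def
proof (intro conjI ballI)
  show "- \<real>\<^sub>\<le>\<^sub>0 \<noteq> ({} :: complex set)"
    using ComplI[of 1 "\<real>\<^sub>\<le>\<^sub>0 :: complex set"] by fastforce
  show "continuous_on (- \<real>\<^sub>\<le>\<^sub>0) Ln"
    by (intro continuous_intros) auto
  show "exp (Ln w) = w" if "w \<in> - \<real>\<^sub>\<le>\<^sub>0" for w
    using that by (intro exp_Ln) auto
qed (simp add: open_Compl)

text \<open>The principal branch is rotated so that its cut lies on the ray opposite to \<open>w\<close>.\<close>
lemma ex_log_branch:
  assumes "w \<noteq> 0"
  shows "\<exists>L V. log_branch L V \<and> w \<in> V"
proof (intro exI conjI)
  let ?V = "(\<lambda>v. v / w) -` (- \<real>\<^sub>\<le>\<^sub>0)"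
  show w: "w \<in> ?V"
    using assms by simp
  show "log_branch (\<lambda>v. Ln (v / w) + Ln w) ?V"
    unfolding log_branch_def
  proof (intro conjI ballI)
    show "open ?V"
      using assms by (intro open_vimage continuous_intros) (auto simp: open_Compl)
    show "continuous_on ?V (\<lambda>v. Ln (v / w) + Ln w)"
      using assms by (intro continuous_intros) auto
    show "exp (Ln (v / w) + Ln w) = v" if "v \<in> ?V" for v
    proof -
      have "v / w \<noteq> 0"
        using that by force
      then show ?thesis
        using assms by (simp add: exp_add)
    qed
  qed (use w in blast)
qed

theorem theorem5p1:
  fixes h :: real
  assumes "h \<noteq> 0"
  shows "(\<forall>L V. \<forall>y::real. log_branch L V \<longrightarrow>
            h_eigenfunction_on h {x. 1 + of_real h * x \<in> V}
              (\<lambda>x. deformed_exp L h x y) (of_real y)) \<and>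
         (\<forall>x::complex. x \<noteq> - 1 / of_real h \<longrightarrow>
            (\<exists>L V. log_branch L V \<and> 1 + of_real h * x \<in> V)) \<and>
         (\<forall>y::real. h_eigenfunction_on h {x. 1 + of_real h * x \<notin> \<real>\<^sub>\<le>\<^sub>0}
            (\<lambda>x. (1 + of_real h * x) powr of_real (y / h)) (of_real y))"
proof (intro conjI allI impI)
  fix L V and y :: real
  assume "log_branch L V"
  then show "h_eigenfunction_on h {x. 1 + of_real h * x \<in> V}
               (\<lambda>x. deformed_exp L h x y) (of_real y)"
    by (rule h_eigenfunction_on_log_branch[OF assms]) simp
next
  fix x :: complex
  assume "x \<noteq> - 1 / of_real h"
  then have "1 + of_real h * x \<noteq> 0"
    using assms by (auto simp: field_simps add_eq_0_iff)
  then show "\<exists>L V. log_branch L V \<and> 1 + of_real h * x \<in> V"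
    by (rule ex_log_branch)
next
  fix y :: real
  have "(1 + of_real h * x) powr of_real (y / h) = deformed_exp Ln h x y"
    if "1 + of_real h * x \<in> - \<real>\<^sub>\<le>\<^sub>0" for x
  proof -
    have "1 + of_real h * x \<noteq> 0"
      using that by force
    then show ?thesis
      by (simp add: powr_def deformed_exp_def)
  qed
  from h_eigenfunction_on_log_branch[OF assms log_branch_Ln this]
  show "h_eigenfunction_on h {x. 1 + of_real h * x \<notin> \<real>\<^sub>\<le>\<^sub>0}
          (\<lambda>x. (1 + of_real h * x) powr of_real (y / h)) (of_real y)"
    by simp
qed

end
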